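(* Let $A$ be a commutative Noetherian ring containing an uncountable field $K$ of characteristic zero, let $m\ge 1$, and let $M=\bigoplus_{n\in\mathbb{Z}}M_n$ be a countably generated, generalized Eulerian $A_m(A)$-module. Then: if $M_{n_0}\neq 0$ for some $n_0\ge -m+1$, then $M_n\neq 0$ for all $n\ge n_0$; if $M_{n_0}\neq 0$ for some $n_0\le -m$, then $M_n\neq 0$ for all $n\le n_0$.
   Context: $A_m(A)=A\otimes_K A_m(K)=A\langle X_1,\ldots,X_m,\partial_1,\ldots,\partial_m\rangle$ is the $m$-th Weyl algebra over $A$: elements of $A$ are central, the $X_i$ commute with each other, the $\partial_i$ commute with each other, and $\partial_iX_j-X_j\partial_i=\delta_{ij}$. It is $\mathbb{Z}$-graded by $\deg z=0$ for $z\in A$, $\deg X_i=1$, $\deg\partial_i=-1$. Modules are left modules. The Euler operator is $\mathcal{E}_m=\sum_{i=1}^m X_i\partial_i$. A graded $A_m(A)$-module $M$ is generalized Eulerian if for each homogeneous $y\in M$ of degree $|y|$ there is a positive integer $a$ (depending on $y$) with $(\mathcal{E}_m-|y|)^a\cdot y=0$. A module is countably generated if it is generated by a countable set of elements. *)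

theory Defs
  imports "HOL-Algebra.Ring_Divisibility" "HOL-Algebra.Subrings" "HOL-Library.Countable_Set"
begin

section \<open>Free associative algebras\<close>

text \<open>The convolution product of the free monoid algebra: the coefficient at a word \<open>w\<close>
  sums over all ways to cut \<open>w\<close> into a prefix and a suffix.\<close>

definition word_conv :: "('a, 'r) ring_scheme \<Rightarrow> ('s list \<Rightarrow> 'a) \<Rightarrow> ('s list \<Rightarrow> 'a) \<Rightarrow> 's list \<Rightarrow> 'a"
  where "word_conv A f g w = (\<Oplus>\<^bsub>A\<^esub>k\<in>{..length w}. f (take k w) \<otimes>\<^bsub>A\<^esub> g (drop k w))"

text \<open>\<open>free_algebra A S\<close> is the free associative algebra \<open>A\<langle>S\<rangle>\<close> over the commutative ring \<open>A\<close>. An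
  element is given by its coefficient function on words; the coefficients commute with the letters.\<close>

definition free_algebra :: "('a, 'r) ring_scheme \<Rightarrow> 's set \<Rightarrow> ('s list \<Rightarrow> 'a) ring"
  where "free_algebra A S =
    \<lparr>carrier = {f. (\<forall>w. f w \<in> carrier A) \<and> finite {w. f w \<noteq> \<zero>\<^bsub>A\<^esub>} \<and> {w. f w \<noteq> \<zero>\<^bsub>A\<^esub>} \<subseteq> lists S},
     monoid.mult = word_conv A,
     one = (\<lambda>w. if w = [] then \<one>\<^bsub>A\<^esub> else \<zero>\<^bsub>A\<^esub>),
     zero = (\<lambda>w. \<zero>\<^bsub>A\<^esub>),
     add = (\<lambda>f g w. f w \<oplus>\<^bsub>A\<^esub> g w)\<rparr>"

definition free_var :: "('a, 'r) ring_scheme \<Rightarrow> 's \<Rightarrow> 's list \<Rightarrow> 'a"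
  where "free_var A s = (\<lambda>w. if w = [s] then \<one>\<^bsub>A\<^esub> else \<zero>\<^bsub>A\<^esub>)"

section \<open>The Weyl algebra\<close>

datatype weyl_gen = Gen_X nat | Gen_D nat

definition weyl_gens :: "nat \<Rightarrow> weyl_gen set"
  where "weyl_gens m = Gen_X ` {1..m} \<union> Gen_D ` {1..m}"

text \<open>Centrality of the elements of \<open>A\<close> needs no relation, since it already holds in the free algebra.\<close>

definition weyl_relations :: "('a, 'r) ring_scheme \<Rightarrow> nat \<Rightarrow> (weyl_gen list \<Rightarrow> 'a) set"
  where "weyl_relations A m =
    (let F = free_algebra A (weyl_gens m);
         x = (\<lambda>i. free_var A (Gen_X i));
         d = (\<lambda>i. free_var A (Gen_D i))
     in {x i \<otimes>\<^bsub>F\<^esub> x j \<ominus>\<^bsub>F\<^esub> x j \<otimes>\<^bsub>F\<^esub> x i | i j. i \<in> {1..m} \<and> j \<in> {1..m}}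
      \<union> {d i \<otimes>\<^bsub>F\<^esub> d j \<ominus>\<^bsub>F\<^esub> d j \<otimes>\<^bsub>F\<^esub> d i | i j. i \<in> {1..m} \<and> j \<in> {1..m}}
      \<union> {(d i \<otimes>\<^bsub>F\<^esub> x j \<ominus>\<^bsub>F\<^esub> x j \<otimes>\<^bsub>F\<^esub> d i) \<ominus>\<^bsub>F\<^esub> (if i = j then \<one>\<^bsub>F\<^esub> else \<zero>\<^bsub>F\<^esub>)
          | i j. i \<in> {1..m} \<and> j \<in> {1..m}})"

definition weyl_ideal :: "('a, 'r) ring_scheme \<Rightarrow> nat \<Rightarrow> (weyl_gen list \<Rightarrow> 'a) set"
  where "weyl_ideal A m = Idl\<^bsub>free_algebra A (weyl_gens m)\<^esub> (weyl_relations A m)"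

definition weyl_algebra :: "('a, 'r) ring_scheme \<Rightarrow> nat \<Rightarrow> (weyl_gen list \<Rightarrow> 'a) set ring"
  where "weyl_algebra A m = free_algebra A (weyl_gens m) Quot weyl_ideal A m"

definition weyl_class ::
    "('a, 'r) ring_scheme \<Rightarrow> nat \<Rightarrow> (weyl_gen list \<Rightarrow> 'a) \<Rightarrow> (weyl_gen list \<Rightarrow> 'a) set"
  where "weyl_class A m f = weyl_ideal A m +>\<^bsub>free_algebra A (weyl_gens m)\<^esub> f"

definition weyl_X :: "('a, 'r) ring_scheme \<Rightarrow> nat \<Rightarrow> nat \<Rightarrow> (weyl_gen list \<Rightarrow> 'a) set"
  where "weyl_X A m i = weyl_class A m (free_var A (Gen_X i))"

definition weyl_D :: "('a, 'r) ring_scheme \<Rightarrow> nat \<Rightarrow> nat \<Rightarrow> (weyl_gen list \<Rightarrow> 'a) set"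
  where "weyl_D A m i = weyl_class A m (free_var A (Gen_D i))"

definition weyl_euler :: "('a, 'r) ring_scheme \<Rightarrow> nat \<Rightarrow> (weyl_gen list \<Rightarrow> 'a) set"
  where "weyl_euler A m =
    (\<Oplus>\<^bsub>weyl_algebra A m\<^esub>i\<in>{1..m}. weyl_X A m i \<otimes>\<^bsub>weyl_algebra A m\<^esub> weyl_D A m i)"

fun gen_degree :: "weyl_gen \<Rightarrow> int"
  where "gen_degree (Gen_X i) = 1" | "gen_degree (Gen_D i) = - 1"

definition word_degree :: "weyl_gen list \<Rightarrow> int"
  where "word_degree w = sum_list (map gen_degree w)"

text \<open>The Weyl relations are homogeneous, so the grading of the free algebra by \<open>word_degree\<close>
  descends; the component of degree \<open>d\<close> is the image of the combinations of words of degree \<open>d\<close>.\<close>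

definition weyl_component :: "('a, 'r) ring_scheme \<Rightarrow> nat \<Rightarrow> int \<Rightarrow> (weyl_gen list \<Rightarrow> 'a) set set"
  where "weyl_component A m d = weyl_class A m `
    {f \<in> carrier (free_algebra A (weyl_gens m)). \<forall>w. f w \<noteq> \<zero>\<^bsub>A\<^esub> \<longrightarrow> word_degree w = d}"

section \<open>Left modules over a not necessarily commutative ring\<close>

text \<open>The library locale for modules asks for a commutative ring of scalars; its record is reused.
  The ring structure of a module record (\<open>mult\<close>, \<open>one\<close>) plays no role.\<close>

locale left_module = R?: ring R + M?: abelian_group M
  for R :: "('a, 'r) ring_scheme" (structure) and M :: "('a, 'b, 'c) module_scheme" (structure) +
  assumes smult_closed [simp, intro]:
      "\<lbrakk>a \<in> carrier R; x \<in> carrier M\<rbrakk> \<Longrightarrow> a \<odot>\<^bsub>M\<^esub> x \<in> carrier M"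
    and smult_l_distr:
      "\<lbrakk>a \<in> carrier R; b \<in> carrier R; x \<in> carrier M\<rbrakk> \<Longrightarrow>
       (a \<oplus>\<^bsub>R\<^esub> b) \<odot>\<^bsub>M\<^esub> x = a \<odot>\<^bsub>M\<^esub> x \<oplus>\<^bsub>M\<^esub> b \<odot>\<^bsub>M\<^esub> x"
    and smult_r_distr:
      "\<lbrakk>a \<in> carrier R; x \<in> carrier M; y \<in> carrier M\<rbrakk> \<Longrightarrow>
       a \<odot>\<^bsub>M\<^esub> (x \<oplus>\<^bsub>M\<^esub> y) = a \<odot>\<^bsub>M\<^esub> x \<oplus>\<^bsub>M\<^esub> a \<odot>\<^bsub>M\<^esub> y"
    and smult_assoc:
      "\<lbrakk>a \<in> carrier R; b \<in> carrier R; x \<in> carrier M\<rbrakk> \<Longrightarrow>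
       (a \<otimes>\<^bsub>R\<^esub> b) \<odot>\<^bsub>M\<^esub> x = a \<odot>\<^bsub>M\<^esub> (b \<odot>\<^bsub>M\<^esub> x)"
    and smult_one [simp]:
      "x \<in> carrier M \<Longrightarrow> \<one>\<^bsub>R\<^esub> \<odot>\<^bsub>M\<^esub> x = x"

definition generated_submodule ::
    "('a, 'r) ring_scheme \<Rightarrow> ('a, 'b, 'c) module_scheme \<Rightarrow> 'b set \<Rightarrow> 'b set"
  where "generated_submodule R M C = \<Inter>{N. submodule N R M \<and> C \<subseteq> N}"

definition countably_generated :: "('a, 'r) ring_scheme \<Rightarrow> ('a, 'b, 'c) module_scheme \<Rightarrow> bool"
  where "countably_generated R M \<longleftrightarrow>
    (\<exists>C \<subseteq> carrier M. countable C \<and> generated_submodule R M C = carrier M)"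

text \<open>\<open>Rg\<close> is the family of homogeneous components of the ring \<open>R\<close>, and \<open>Mg\<close> that of \<open>M\<close>.\<close>

locale graded_left_module = left_module R M
  for R :: "('a, 'r) ring_scheme" (structure) and Rg :: "int \<Rightarrow> 'a set"
    and M :: "('a, 'b, 'c) module_scheme" (structure) and Mg :: "int \<Rightarrow> 'b set" +
  assumes component_subgroup: "additive_subgroup (Mg n) M"
    and direct_sum:
      "x \<in> carrier M \<Longrightarrow>
       \<exists>!c. (\<forall>n. c n \<in> Mg n) \<and> finite {n. c n \<noteq> \<zero>\<^bsub>M\<^esub>} \<and> x = (\<Oplus>\<^bsub>M\<^esub>n\<in>{n. c n \<noteq> \<zero>\<^bsub>M\<^esub>}. c n)"
    and smult_degree:
      "\<lbrakk>a \<in> Rg d; x \<in> Mg n\<rbrakk> \<Longrightarrow> a \<odot>\<^bsub>M\<^esub> x \<in> Mg (d + n)"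

definition generalized_eulerian ::
    "('a, 'r) ring_scheme \<Rightarrow> nat \<Rightarrow> ((weyl_gen list \<Rightarrow> 'a) set, 'b, 'c) module_scheme
      \<Rightarrow> (int \<Rightarrow> 'b set) \<Rightarrow> bool"
  where "generalized_eulerian A m M Mg \<longleftrightarrow>
    (\<forall>n. \<forall>y \<in> Mg n. \<exists>a::nat. a > 0 \<and>
      ((weyl_euler A m \<ominus>\<^bsub>weyl_algebra A m\<^esub> [n] \<cdot>\<^bsub>weyl_algebra A m\<^esub> \<one>\<^bsub>weyl_algebra A m\<^esub>)
        [^]\<^bsub>weyl_algebra A m\<^esub> a) \<odot>\<^bsub>M\<^esub> y = \<zero>\<^bsub>M\<^esub>)"

definition characteristic_zero :: "('a, 'r) ring_scheme \<Rightarrow> bool"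
  where "characteristic_zero R \<longleftrightarrow> (\<forall>n::nat. n > 0 \<longrightarrow> [n] \<cdot>\<^bsub>R\<^esub> \<one>\<^bsub>R\<^esub> \<noteq> \<zero>\<^bsub>R\<^esub>)"

section \<open>The free algebra and the Weyl algebra are rings\<close>

context cring
begin

lemma word_conv_Nil:
  assumes "\<And>w. f w \<in> carrier R" "\<And>w. g w \<in> carrier R"
  shows "word_conv R f g [] = f [] \<otimes> g []"
  using assms by (simp add: word_conv_def)

lemma word_conv_Cons:
  assumes "\<And>w. f w \<in> carrier R" "\<And>w. g w \<in> carrier R"
  shows "word_conv R f g (x # w) = f [] \<otimes> g (x # w) \<oplus> word_conv R (\<lambda>v. f (x # v)) g w"
proof -
  have "word_conv R f g (x # w)
      = (\<Oplus>k\<in>{..Suc (length w)}. f (take k (x # w)) \<otimes> g (drop k (x # w)))"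
    by (simp add: word_conv_def)
  also have "\<dots> = (\<Oplus>k\<in>{..length w}. f (take (Suc k) (x # w)) \<otimes> g (drop (Suc k) (x # w)))
      \<oplus> f (take 0 (x # w)) \<otimes> g (drop 0 (x # w))"
    by (rule finsum_Suc2) (use assms in auto)
  finally show ?thesis
    using assms by (simp add: word_conv_def a_comm)
qed

lemma word_conv_closed:
  assumes "\<And>w. f w \<in> carrier R" "\<And>w. g w \<in> carrier R"
  shows "word_conv R f g w \<in> carrier R"
  using assms by (auto simp: word_conv_def)

lemma word_conv_add_left:
  assumes "\<And>w. f w \<in> carrier R" "\<And>w. g w \<in> carrier R" "\<And>w. h w \<in> carrier R"
  shows "word_conv R (\<lambda>v. f v \<oplus> g v) h w = word_conv R f h w \<oplus> word_conv R g h w"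
  using assms by (simp add: word_conv_def l_distr finsum_addf)

lemma word_conv_add_right:
  assumes "\<And>w. f w \<in> carrier R" "\<And>w. g w \<in> carrier R" "\<And>w. h w \<in> carrier R"
  shows "word_conv R h (\<lambda>v. f v \<oplus> g v) w = word_conv R h f w \<oplus> word_conv R h g w"
  using assms by (simp add: word_conv_def r_distr finsum_addf)

lemma word_conv_scale_left:
  assumes "\<And>w. f w \<in> carrier R" "\<And>w. g w \<in> carrier R" "a \<in> carrier R"
  shows "word_conv R (\<lambda>v. a \<otimes> f v) g w = a \<otimes> word_conv R f g w"
  using assms by (simp add: word_conv_def m_assoc finsum_rdistr)

lemma word_conv_assoc:
  assumes "\<And>w. f w \<in> carrier R" "\<And>w. g w \<in> carrier R" "\<And>w. h w \<in> carrier R"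
  shows "word_conv R (word_conv R f g) h w = word_conv R f (word_conv R g h) w"
  using assms
proof (induction w arbitrary: f g h)
  case Nil
  then show ?case by (simp add: word_conv_Nil word_conv_closed m_assoc)
next
  case (Cons x w)
  have "word_conv R (word_conv R f g) h (x # w)
      = (f [] \<otimes> g []) \<otimes> h (x # w)
        \<oplus> word_conv R (\<lambda>v. f [] \<otimes> g (x # v) \<oplus> word_conv R (\<lambda>u. f (x # u)) g v) h w"
    using Cons.prems by (simp add: word_conv_Cons word_conv_Nil word_conv_closed)
  also have "\<dots> = (f [] \<otimes> g []) \<otimes> h (x # w)
        \<oplus> (f [] \<otimes> word_conv R (\<lambda>v. g (x # v)) h w
        \<oplus> word_conv R (\<lambda>u. f (x # u)) (word_conv R g h) w)"
    using Cons.prems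
    by (simp add: word_conv_add_left word_conv_scale_left word_conv_closed Cons.IH)
  also have "\<dots> = word_conv R f (word_conv R g h) (x # w)"
    using Cons.prems by (simp add: word_conv_Cons word_conv_closed m_assoc a_assoc r_distr)
  finally show ?case .
qed

lemma word_conv_one_left:
  assumes "\<And>w. f w \<in> carrier R"
  shows "word_conv R (\<lambda>w. if w = [] then \<one> else \<zero>) f w = f w"
proof (cases w)
  case Nil
  then show ?thesis using assms by (simp add: word_conv_Nil)
next
  case (Cons x v)
  have "word_conv R (\<lambda>u. \<zero>) f v = \<zero>"
    using assms by (simp add: word_conv_def)
  then show ?thesis using assms Cons by (simp add: word_conv_Cons)
qed

lemma word_conv_one_right:
  assumes "\<And>w. f w \<in> carrier R"
  shows "word_conv R f (\<lambda>w. if w = [] then \<one> else \<zero>) w = f w"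
  using assms by (induction w arbitrary: f) (simp_all add: word_conv_Nil word_conv_Cons)

lemma word_conv_support:
  assumes "\<And>w. f w \<in> carrier R" "\<And>w. g w \<in> carrier R"
  shows "{w. word_conv R f g w \<noteq> \<zero>} \<subseteq> (\<lambda>(u, v). u @ v) ` ({w. f w \<noteq> \<zero>} \<times> {w. g w \<noteq> \<zero>})"
proof
  fix w assume w: "w \<in> {w. word_conv R f g w \<noteq> \<zero>}"
  have "\<exists>k. f (take k w) \<noteq> \<zero> \<and> g (drop k w) \<noteq> \<zero>"
  proof (rule ccontr)
    assume *: "\<not> ?thesis"
    have "f (take k w) \<otimes> g (drop k w) = \<zero>" for k
      using * assms by (cases "f (take k w) = \<zero>") auto
    then have "word_conv R f g w = \<zero>" by (simp add: word_conv_def)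
    with w show False by simp
  qed
  then obtain k where "f (take k w) \<noteq> \<zero>" "g (drop k w) \<noteq> \<zero>" by blast
  then show "w \<in> (\<lambda>(u, v). u @ v) ` ({w. f w \<noteq> \<zero>} \<times> {w. g w \<noteq> \<zero>})"
    by (intro image_eqI[of _ _ "(take k w, drop k w)"]) auto
qed

lemma free_algebra_carrierI:
  assumes "\<And>w. f w \<in> carrier R" "{w. f w \<noteq> \<zero>} \<subseteq> B" "finite B" "B \<subseteq> lists S"
  shows "f \<in> carrier (free_algebra R S)"
  using assms finite_subset[OF assms(2,3)] subset_trans[OF assms(2,4)]
  by (simp add: free_algebra_def)

lemma free_algebra_carrierD:
  assumes "f \<in> carrier (free_algebra R S)"
  shows "f w \<in> carrier R" "finite {w. f w \<noteq> \<zero>}" "{w. f w \<noteq> \<zero>} \<subseteq> lists S"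
  using assms by (simp_all add: free_algebra_def)

lemma free_algebra_ring: "ring (free_algebra R S)"
proof (rule ringI)
  show "abelian_group (free_algebra R S)"
  proof (rule abelian_groupI)
    fix f g assume fg: "f \<in> carrier (free_algebra R S)" "g \<in> carrier (free_algebra R S)"
    have "(\<lambda>w. f w \<oplus> g w) \<in> carrier (free_algebra R S)"
      using free_algebra_carrierD[OF fg(1)] free_algebra_carrierD[OF fg(2)]
      by (intro free_algebra_carrierI[of _ "{w. f w \<noteq> \<zero>} \<union> {w. g w \<noteq> \<zero>}"]) auto
    then show "f \<oplus>\<^bsub>free_algebra R S\<^esub> g \<in> carrier (free_algebra R S)"
      by (simp add: free_algebra_def)
  next
    fix f assume f: "f \<in> carrier (free_algebra R S)"
    have "(\<lambda>w. \<ominus> f w) \<in> carrier (free_algebra R S)"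
      using free_algebra_carrierD[OF f]
      by (intro free_algebra_carrierI[of _ "{w. f w \<noteq> \<zero>}"]) auto
    then show "\<exists>g\<in>carrier (free_algebra R S).
        g \<oplus>\<^bsub>free_algebra R S\<^esub> f = \<zero>\<^bsub>free_algebra R S\<^esub>"
      using free_algebra_carrierD(1)[OF f]
      by (intro bexI[of _ "\<lambda>w. \<ominus> f w"]) (simp_all add: free_algebra_def l_neg)
  qed (auto simp: free_algebra_def a_ac)
  show "monoid (free_algebra R S)"
  proof (rule monoidI)
    fix f g assume fg: "f \<in> carrier (free_algebra R S)" "g \<in> carrier (free_algebra R S)"
    then have c: "\<And>w. f w \<in> carrier R" "\<And>w. g w \<in> carrier R"
      and fin: "finite ({w. f w \<noteq> \<zero>} \<times> {w. g w \<noteq> \<zero>})"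
      and sub: "{w. f w \<noteq> \<zero>} \<subseteq> lists S" "{w. g w \<noteq> \<zero>} \<subseteq> lists S"
      using free_algebra_carrierD[OF fg(1)] free_algebra_carrierD[OF fg(2)] by auto
    have "(\<lambda>(u, v). u @ v) ` ({w. f w \<noteq> \<zero>} \<times> {w. g w \<noteq> \<zero>}) \<subseteq> lists S"
      using sub by (fastforce simp: subset_iff)
    from free_algebra_carrierI[OF word_conv_closed[OF c] word_conv_support[OF c]
        finite_imageI[OF fin] this]
    show "f \<otimes>\<^bsub>free_algebra R S\<^esub> g \<in> carrier (free_algebra R S)"
      by (simp add: free_algebra_def)
  next
    fix f g h assume "f \<in> carrier (free_algebra R S)" "g \<in> carrier (free_algebra R S)"
      "h \<in> carrier (free_algebra R S)"
    then show "(f \<otimes>\<^bsub>free_algebra R S\<^esub> g) \<otimes>\<^bsub>free_algebra R S\<^esub> h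
        = f \<otimes>\<^bsub>free_algebra R S\<^esub> (g \<otimes>\<^bsub>free_algebra R S\<^esub> h)"
      by (auto simp: free_algebra_def word_conv_assoc)
  qed (auto simp: free_algebra_def word_conv_one_left word_conv_one_right)
qed (auto simp: free_algebra_def word_conv_add_left word_conv_add_right)

lemma free_var_closed: "s \<in> S \<Longrightarrow> free_var R s \<in> carrier (free_algebra R S)"
  by (auto simp: free_algebra_def free_var_def)

lemma weyl_relations_subset: "weyl_relations R m \<subseteq> carrier (free_algebra R (weyl_gens m))"
proof -
  interpret F: ring "free_algebra R (weyl_gens m)" by (rule free_algebra_ring)
  have "free_var R (Gen_X i) \<in> carrier (free_algebra R (weyl_gens m))"
    "free_var R (Gen_D i) \<in> carrier (free_algebra R (weyl_gens m))" if "i \<in> {1..m}" for i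
    using that by (auto intro!: free_var_closed simp: weyl_gens_def)
  then show ?thesis
    unfolding weyl_relations_def Let_def by (auto intro!: F.m_closed F.minus_closed)
qed

lemma weyl_ideal_ideal: "ideal (weyl_ideal R m) (free_algebra R (weyl_gens m))"
  unfolding weyl_ideal_def
  by (rule ring.genideal_ideal[OF free_algebra_ring weyl_relations_subset])

lemma weyl_algebra_ring: "ring (weyl_algebra R m)"
  unfolding weyl_algebra_def by (rule ideal.quotient_is_ring[OF weyl_ideal_ideal])

end

end

theory Submission
  imports Defs
begin

text \<open>
  Multiplication by \<open>X\<^sub>i\<close> raises the degree by one and multiplication by \<open>\<partial>\<^sub>i\<close> lowers it by one, so
  if \<open>M\<^sub>n\<^sub>+\<^sub>1 = 0\<close> then all \<open>X\<^sub>i\<close> annihilate \<open>M\<^sub>n\<close>, and if \<open>M\<^sub>n\<^sub>-\<^sub>1 = 0\<close> then all \<open>\<partial>\<^sub>i\<close> do.  On such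
  elements the Euler operator is an integer scalar: if every \<open>\<partial>\<^sub>i\<close> kills \<open>y\<close> then \<open>\<E> y = 0\<close>, and if
  every \<open>X\<^sub>i\<close> kills \<open>y\<close> then \<open>\<E> y = - m y\<close>, because \<open>\<E> = (\<Sum>i. \<partial>\<^sub>i X\<^sub>i) - m\<close>.  Hence some power of the
  integer \<open>- n\<close>, respectively \<open>- m - n\<close>, annihilates a homogeneous \<open>y\<close> of degree \<open>n\<close>.

  The field \<open>K\<close> of characteristic zero makes every nonzero integer invertible in the Weyl algebra
  (\<open>weyl_int_unit\<close>), so \<open>y = 0\<close> unless \<open>n = 0\<close>, respectively \<open>n = - m\<close>.  Thus a nonzero component
  can be followed by a zero one only in degree \<open>- m\<close> and preceded by one only in degree \<open>0\<close>.  The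
  range \<open>n \<ge> - m + 1\<close> avoids the former, and \<open>n \<le> - m\<close> avoids the latter because
  \<open>m \<ge> 1\<close>.  Induction then carries nonvanishing to the end of each range.
\<close>

section \<open>Integers in a ring\<close>

lemma ring_hom_add_pow:
  fixes k :: int
  assumes "ring R" "ring S" "h \<in> ring_hom R S" "x \<in> carrier R"
  shows "h ([k] \<cdot>\<^bsub>R\<^esub> x) = [k] \<cdot>\<^bsub>S\<^esub> h x"
proof -
  interpret h: ring_hom_ring R S h
    by (rule ring_hom_ringI2[OF assms(1-3)])
  interpret G: group_hom "add_monoid R" "add_monoid S" h
    by (rule h.a_group_hom)
  show ?thesis
    using G.hom_int_pow[of x k] assms(4) by (simp add: add_pow_def)
qed

lemma ring_hom_int_unit:
  fixes k :: int
  assumes "ring R" "ring S" "h \<in> ring_hom R S" "[k] \<cdot>\<^bsub>R\<^esub> \<one>\<^bsub>R\<^esub> \<in> Units R"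
  shows "[k] \<cdot>\<^bsub>S\<^esub> \<one>\<^bsub>S\<^esub> \<in> Units S"
proof -
  interpret h: ring_hom_ring R S h
    by (rule ring_hom_ringI2[OF assms(1-3)])
  obtain v where v: "v \<in> carrier R" "v \<otimes>\<^bsub>R\<^esub> ([k] \<cdot>\<^bsub>R\<^esub> \<one>\<^bsub>R\<^esub>) = \<one>\<^bsub>R\<^esub>" "([k] \<cdot>\<^bsub>R\<^esub> \<one>\<^bsub>R\<^esub>) \<otimes>\<^bsub>R\<^esub> v = \<one>\<^bsub>R\<^esub>"
    using assms(4) unfolding Units_def by auto
  have k: "[k] \<cdot>\<^bsub>R\<^esub> \<one>\<^bsub>R\<^esub> \<in> carrier R" by simp
  have "h ([k] \<cdot>\<^bsub>R\<^esub> \<one>\<^bsub>R\<^esub>) = [k] \<cdot>\<^bsub>S\<^esub> \<one>\<^bsub>S\<^esub>"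
    using ring_hom_add_pow[OF assms(1-3), of "\<one>\<^bsub>R\<^esub>" k] by simp
  moreover have "h v \<otimes>\<^bsub>S\<^esub> h ([k] \<cdot>\<^bsub>R\<^esub> \<one>\<^bsub>R\<^esub>) = \<one>\<^bsub>S\<^esub>" "h ([k] \<cdot>\<^bsub>R\<^esub> \<one>\<^bsub>R\<^esub>) \<otimes>\<^bsub>S\<^esub> h v = \<one>\<^bsub>S\<^esub>"
    using v k by (metis h.hom_mult h.hom_one)+
  ultimately show ?thesis
    using v(1) unfolding Units_def by auto
qed

lemma (in field) characteristic_zero_int_unit:
  fixes k :: int
  assumes "characteristic_zero R" "k \<noteq> 0"
  shows "[k] \<cdot> \<one> \<in> Units R"
proof -
  have "[int n] \<cdot> \<one> \<noteq> \<zero>" if "n > 0" for n :: nat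
    using assms(1) that by (simp add: characteristic_zero_def add_pow_int_ge)
  moreover have "[(- int n)] \<cdot> \<one> \<noteq> \<zero>" if "n > 0" for n :: nat
  proof
    assume *: "[(- int n)] \<cdot> \<one> = \<zero>"
    have "[int n] \<cdot> \<one> = [(- (- int n))] \<cdot> \<one>" by simp
    also have "\<dots> = \<ominus> ([(- int n)] \<cdot> \<one>)" by (rule add.int_pow_neg) simp
    finally have "[int n] \<cdot> \<one> = \<zero>" using * by simp
    with assms(1) that show False by (simp add: characteristic_zero_def add_pow_int_ge)
  qed
  ultimately have "[k] \<cdot> \<one> \<noteq> \<zero>"
    using assms(2) by (cases k rule: int_cases2) auto
  then show ?thesis by (simp add: field_Units)
qed

lemma (in ring) int_mult_commute:
  fixes k :: int
  assumes "g \<in> carrier R"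
  shows "g \<otimes> ([k] \<cdot> \<one>) = ([k] \<cdot> \<one>) \<otimes> g"
  using assms add_pow_ldistr_int[of \<one> g k] add_pow_rdistr_int[of g \<one> k] by simp

lemma (in ring) int_mult_zero: "[(0::int)] \<cdot> x = \<zero>"
  by (simp add: add_pow_int_ge)

section \<open>Scalars of the Weyl algebra\<close>

context cring
begin

lemma weyl_class_ring_hom:
  "weyl_class R m \<in> ring_hom (free_algebra R (weyl_gens m)) (weyl_algebra R m)"
proof -
  have "weyl_class R m = (+>\<^bsub>free_algebra R (weyl_gens m)\<^esub>) (weyl_ideal R m)"
    by (auto simp: weyl_class_def)
  then show ?thesis
    using ideal.rcos_ring_hom[OF weyl_ideal_ideal] by (simp add: weyl_algebra_def)
qed

lemma free_algebra_const_ring_hom: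
  fixes S :: "'s set"
  shows "(\<lambda>a w. if w = [] then a else \<zero>) \<in> ring_hom R (free_algebra R S)"
proof (rule ring_hom_memI)
  fix a b assume ab: "a \<in> carrier R" "b \<in> carrier R"
  have "word_conv R (\<lambda>w. if w = [] then a else \<zero>) (\<lambda>w. if w = [] then b else \<zero>) w
      = (if w = [] then a \<otimes> b else \<zero>)" for w :: "'s list"
  proof -
    \<comment> \<open>The left factor is \<open>a\<close> times the unit of the free algebra.\<close>
    have "word_conv R (\<lambda>w. if w = [] then a else \<zero>) (\<lambda>w. if w = [] then b else \<zero>) w
        = word_conv R (\<lambda>v. a \<otimes> (if v = [] then \<one> else \<zero>)) (\<lambda>w. if w = [] then b else \<zero>) w"
      using ab by (intro arg_cong[where f = "\<lambda>f. word_conv R f _ w"]) auto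
    also have "\<dots> = a \<otimes> (if w = [] then b else \<zero>)"
      using ab by (simp add: word_conv_scale_left word_conv_one_left)
    finally show ?thesis using ab by auto
  qed
  then show "(\<lambda>w. if w = [] then a \<otimes> b else \<zero>) =
      (\<lambda>w. if w = [] then a else \<zero>) \<otimes>\<^bsub>free_algebra R S\<^esub> (\<lambda>w. if w = [] then b else \<zero>)"
    by (simp add: free_algebra_def fun_eq_iff)
qed (auto simp: free_algebra_def)

text \<open>Nonzero integers are invertible in the field \<open>K\<close> and stay so under the ring
  homomorphisms from \<open>K\<close> to \<open>R\<close>, then to the free algebra and to its quotient.\<close>

lemma weyl_int_unit:
  fixes k :: int
  assumes "subfield K R" "characteristic_zero (R\<lparr>carrier := K\<rparr>)" "k \<noteq> 0"
  shows "[k] \<cdot>\<^bsub>weyl_algebra R m\<^esub> \<one>\<^bsub>weyl_algebra R m\<^esub> \<in> Units (weyl_algebra R m)"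
proof -
  have K: "field (R\<lparr>carrier := K\<rparr>)"
    by (rule subfield_iff(2)[OF assms(1)])
  have "(\<lambda>x. x) \<in> ring_hom (R\<lparr>carrier := K\<rparr>) R"
    using subfieldE(3)[OF assms(1)] by (intro ring_hom_memI) auto
  from ring_hom_int_unit[OF field.is_ring[OF K] ring_axioms this
      field.characteristic_zero_int_unit[OF K assms(2,3)]]
  have "[k] \<cdot> \<one> \<in> Units R" .
  from ring_hom_int_unit[OF ring_axioms free_algebra_ring free_algebra_const_ring_hom this]
  show ?thesis
    by (rule ring_hom_int_unit[OF free_algebra_ring weyl_algebra_ring weyl_class_ring_hom])
qed

section \<open>The commutation relation and the grading of the generators\<close>

lemma weyl_gen_closed:
  assumes "i \<in> {1..m}"
  shows "weyl_X R m i \<in> carrier (weyl_algebra R m)"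
    and "weyl_D R m i \<in> carrier (weyl_algebra R m)"
  using assms unfolding weyl_X_def weyl_D_def
  by (auto intro!: ring_hom_closed[OF weyl_class_ring_hom] free_var_closed simp: weyl_gens_def)

lemma weyl_commutator:
  assumes "i \<in> {1..m}"
  shows "weyl_D R m i \<otimes>\<^bsub>weyl_algebra R m\<^esub> weyl_X R m i
      = weyl_X R m i \<otimes>\<^bsub>weyl_algebra R m\<^esub> weyl_D R m i \<oplus>\<^bsub>weyl_algebra R m\<^esub> \<one>\<^bsub>weyl_algebra R m\<^esub>"
proof -
  let ?F = "free_algebra R (weyl_gens m)" and ?W = "weyl_algebra R m"
  let ?x = "free_var R (Gen_X i)" and ?d = "free_var R (Gen_D i)"
  interpret h: ring_hom_ring ?F ?W "weyl_class R m"
    by (rule ring_hom_ringI2[OF free_algebra_ring weyl_algebra_ring weyl_class_ring_hom])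
  let ?r = "(?d \<otimes>\<^bsub>?F\<^esub> ?x \<ominus>\<^bsub>?F\<^esub> ?x \<otimes>\<^bsub>?F\<^esub> ?d) \<ominus>\<^bsub>?F\<^esub> \<one>\<^bsub>?F\<^esub>"
  interpret I: ideal "weyl_ideal R m" ?F by (rule weyl_ideal_ideal)
  have xd: "?x \<in> carrier ?F" "?d \<in> carrier ?F"
    using assms by (auto intro!: free_var_closed simp: weyl_gens_def)
  have "?r \<in> weyl_relations R m"
    unfolding weyl_relations_def Let_def
    by (rule UnI2, rule CollectI, intro exI[of _ i] conjI) (use assms in simp_all)
  then have "?r \<in> weyl_ideal R m"
    unfolding weyl_ideal_def
    using ring.genideal_self[OF free_algebra_ring weyl_relations_subset] by blast
  then have "weyl_class R m ?r = \<zero>\<^bsub>?W\<^esub>"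
    by (simp add: weyl_class_def weyl_algebra_def FactRing_def I.a_rcos_const)
  then have "(weyl_D R m i \<otimes>\<^bsub>?W\<^esub> weyl_X R m i \<ominus>\<^bsub>?W\<^esub> weyl_X R m i \<otimes>\<^bsub>?W\<^esub> weyl_D R m i)
      \<ominus>\<^bsub>?W\<^esub> \<one>\<^bsub>?W\<^esub> = \<zero>\<^bsub>?W\<^esub>"
    using xd by (simp add: weyl_X_def weyl_D_def a_minus_def)
  then have "weyl_D R m i \<otimes>\<^bsub>?W\<^esub> weyl_X R m i \<ominus>\<^bsub>?W\<^esub> weyl_X R m i \<otimes>\<^bsub>?W\<^esub> weyl_D R m i = \<one>\<^bsub>?W\<^esub>"
    using weyl_gen_closed[OF assms] by simp
  moreover have "p = q \<oplus>\<^bsub>?W\<^esub> (p \<ominus>\<^bsub>?W\<^esub> q)" if "p \<in> carrier ?W" "q \<in> carrier ?W" for p q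
    using that by (simp add: a_minus_def h.S.a_lcomm h.S.r_neg)
  ultimately show ?thesis
    using weyl_gen_closed[OF assms] by (metis h.S.m_closed)
qed

lemma weyl_euler_eq:
  "weyl_euler R m = (\<Oplus>\<^bsub>weyl_algebra R m\<^esub>i\<in>{1..m}. weyl_D R m i \<otimes>\<^bsub>weyl_algebra R m\<^esub> weyl_X R m i)
      \<oplus>\<^bsub>weyl_algebra R m\<^esub> ([(- int m)] \<cdot>\<^bsub>weyl_algebra R m\<^esub> \<one>\<^bsub>weyl_algebra R m\<^esub>)"
proof -
  let ?W = "weyl_algebra R m"
  interpret W: ring ?W by (rule weyl_algebra_ring)
  have closed: "weyl_euler R m \<in> carrier ?W"
    unfolding weyl_euler_def using weyl_gen_closed by (auto intro!: W.finsum_closed)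
  have "(\<Oplus>\<^bsub>?W\<^esub>i\<in>{1..m}. weyl_D R m i \<otimes>\<^bsub>?W\<^esub> weyl_X R m i)
      = (\<Oplus>\<^bsub>?W\<^esub>i\<in>{1..m}. weyl_X R m i \<otimes>\<^bsub>?W\<^esub> weyl_D R m i \<oplus>\<^bsub>?W\<^esub> \<one>\<^bsub>?W\<^esub>)"
    using weyl_gen_closed weyl_commutator by (intro W.finsum_cong') auto
  also have "\<dots> = weyl_euler R m \<oplus>\<^bsub>?W\<^esub> (\<Oplus>\<^bsub>?W\<^esub>i\<in>{1..m}. \<one>\<^bsub>?W\<^esub>)"
    unfolding weyl_euler_def using weyl_gen_closed by (intro W.finsum_addf) auto
  also have "(\<Oplus>\<^bsub>?W\<^esub>i\<in>{1..m}. \<one>\<^bsub>?W\<^esub>) = [int m] \<cdot>\<^bsub>?W\<^esub> \<one>\<^bsub>?W\<^esub>"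
    using W.add.finprod_const[of "\<one>\<^bsub>?W\<^esub>" "{1..m}"] by (simp add: add_pow_int_ge)
  finally show ?thesis
    using closed W.add.int_pow_mult[of "\<one>\<^bsub>?W\<^esub>" "int m" "- int m"]
    by (simp add: W.a_assoc W.int_mult_zero)
qed

lemma weyl_gen_component:
  assumes "i \<in> {1..m}"
  shows "weyl_X R m i \<in> weyl_component R m 1"
    and "weyl_D R m i \<in> weyl_component R m (- 1)"
  unfolding weyl_X_def weyl_D_def weyl_component_def
  using assms free_var_closed[of "Gen_X i" "weyl_gens m"] free_var_closed[of "Gen_D i" "weyl_gens m"]
  by (auto intro!: imageI simp: weyl_gens_def free_var_def word_degree_def)

end

section \<open>Annihilation in left modules\<close>

context left_module
begin

lemma smult_zero_left: "y \<in> carrier M \<Longrightarrow> \<zero> \<odot>\<^bsub>M\<^esub> y = \<zero>\<^bsub>M\<^esub>"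
  using smult_l_distr[of \<zero> \<zero> y] by simp

lemma smult_zero_right: "a \<in> carrier R \<Longrightarrow> a \<odot>\<^bsub>M\<^esub> \<zero>\<^bsub>M\<^esub> = \<zero>\<^bsub>M\<^esub>"
  using smult_r_distr[of a "\<zero>\<^bsub>M\<^esub>" "\<zero>\<^bsub>M\<^esub>"] by simp

lemma finsum_mult_smult_zero:
  assumes "y \<in> carrier M" "finite I"
    and "\<And>i. i \<in> I \<Longrightarrow> a i \<in> carrier R" "\<And>i. i \<in> I \<Longrightarrow> b i \<in> carrier R"
    and "\<And>i. i \<in> I \<Longrightarrow> b i \<odot>\<^bsub>M\<^esub> y = \<zero>\<^bsub>M\<^esub>"
  shows "(\<Oplus>i\<in>I. a i \<otimes> b i) \<odot>\<^bsub>M\<^esub> y = \<zero>\<^bsub>M\<^esub>"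
  using assms(2-)
proof (induction I rule: finite_induct)
  case empty
  then show ?case using assms(1) by (simp add: smult_zero_left)
next
  case (insert i I)
  have "(\<Oplus>j\<in>insert i I. a j \<otimes> b j) = a i \<otimes> b i \<oplus> (\<Oplus>j\<in>I. a j \<otimes> b j)"
    using insert by (intro R.finsum_insert) auto
  moreover have "(\<Oplus>j\<in>I. a j \<otimes> b j) \<in> carrier R"
    using insert by (intro R.finsum_closed) auto
  ultimately show ?case
    using insert assms(1) by (simp add: smult_l_distr smult_assoc smult_zero_right)
qed

text \<open>An element killed by \<open>s\<close> is an eigenvector of \<open>s + k\<close> with eigenvalue the integer \<open>k\<close>; since
  integers are central, powers of \<open>s + k\<close> act on it as powers of \<open>k\<close>.\<close>

lemma smult_pow_eigen:
  fixes k :: int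
  assumes "y \<in> carrier M" "s \<in> carrier R" "s \<odot>\<^bsub>M\<^esub> y = \<zero>\<^bsub>M\<^esub>"
  shows "((s \<oplus> ([k] \<cdot> \<one>)) [^] (a::nat)) \<odot>\<^bsub>M\<^esub> y = (([k] \<cdot> \<one>) [^] a) \<odot>\<^bsub>M\<^esub> y"
proof (induction a)
  case 0
  then show ?case by simp
next
  case (Suc a)
  let ?z = "[k] \<cdot> \<one>" and ?g = "s \<oplus> ([k] \<cdot> \<one>)"
  have z: "?z \<in> carrier R" and g: "?g \<in> carrier R" using assms by auto
  have "(?g [^] Suc a) \<odot>\<^bsub>M\<^esub> y = (?g [^] a) \<odot>\<^bsub>M\<^esub> (?z \<odot>\<^bsub>M\<^esub> y)"
    using assms z g by (simp add: smult_assoc smult_l_distr)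
  also have "\<dots> = (?z \<otimes> ?g [^] a) \<odot>\<^bsub>M\<^esub> y"
    using assms(1) z g R.int_mult_commute[of "?g [^] a" k]
    by (simp add: smult_assoc[symmetric])
  also have "\<dots> = (?z \<otimes> ?z [^] a) \<odot>\<^bsub>M\<^esub> y"
    using assms(1) z g Suc by (simp add: smult_assoc)
  also have "?z \<otimes> ?z [^] a = ?z [^] Suc a"
    using z R.nat_pow_Suc2[of ?z a] by simp
  finally show ?case .
qed

lemma unit_smult_eq_zeroD:
  assumes "u \<in> Units R" "y \<in> carrier M" "u \<odot>\<^bsub>M\<^esub> y = \<zero>\<^bsub>M\<^esub>"
  shows "y = \<zero>\<^bsub>M\<^esub>"
proof -
  have "y = (inv u \<otimes> u) \<odot>\<^bsub>M\<^esub> y" using assms by simp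
  also have "\<dots> = \<zero>\<^bsub>M\<^esub>"
    using assms by (simp add: smult_assoc smult_zero_right R.Units_closed del: R.Units_l_inv)
  finally show ?thesis .
qed

text \<open>Applied with \<open>s = \<Sum>i. a\<^sub>i b\<^sub>i\<close>, where the \<open>b\<^sub>i\<close> are the generators that kill \<open>y\<close>, and \<open>k\<close> the
  integer by which the Euler operator differs from \<open>s\<close>.\<close>

lemma generalized_eigenvector_eq_zero:
  fixes k n :: int
  assumes "y \<in> carrier M" "s \<in> carrier R" "s \<odot>\<^bsub>M\<^esub> y = \<zero>\<^bsub>M\<^esub>"
    and "((s \<oplus> ([k] \<cdot> \<one>)) \<ominus> ([n] \<cdot> \<one>)) [^] (a::nat) \<odot>\<^bsub>M\<^esub> y = \<zero>\<^bsub>M\<^esub>"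
    and "[(k - n)] \<cdot> \<one> \<in> Units R"
  shows "y = \<zero>\<^bsub>M\<^esub>"
proof -
  have "(s \<oplus> ([k] \<cdot> \<one>)) \<ominus> ([n] \<cdot> \<one>) = s \<oplus> ([(k - n)] \<cdot> \<one>)"
    using assms(2) R.add.int_pow_diff[of \<one> k n] by (simp add: a_minus_def R.a_assoc)
  then have "([(k - n)] \<cdot> \<one>) [^] a \<odot>\<^bsub>M\<^esub> y = \<zero>\<^bsub>M\<^esub>"
    using assms smult_pow_eigen[of y s "k - n" a] by simp
  then show ?thesis
    by (rule unit_smult_eq_zeroD[OF R.Units_pow_closed[OF assms(5)] assms(1)])
qed

end

section \<open>Neighbouring components\<close>

lemma (in graded_left_module) component_closed: "y \<in> Mg n \<Longrightarrow> y \<in> carrier M"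
  using additive_subgroup.a_Hcarr[OF component_subgroup] .

lemma (in graded_left_module) component_zero: "\<zero>\<^bsub>M\<^esub> \<in> Mg n"
  using additive_subgroup.zero_closed[OF component_subgroup] .

text \<open>If the component of degree \<open>n + 1\<close> vanishes, the Euler operator acts on degree \<open>n\<close> as \<open>- m\<close>.\<close>

lemma weyl_component_ascend:
  assumes "cring A" "subfield K A" "characteristic_zero (A\<lparr>carrier := K\<rparr>)"
    and "graded_left_module (weyl_algebra A m) (weyl_component A m) M Mg"
    and "generalized_eulerian A m M Mg"
    and "n \<noteq> - int m" "Mg n \<noteq> {\<zero>\<^bsub>M\<^esub>}"
  shows "Mg (n + 1) \<noteq> {\<zero>\<^bsub>M\<^esub>}"
proof
  assume zero: "Mg (n + 1) = {\<zero>\<^bsub>M\<^esub>}"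
  interpret A: cring A by fact
  interpret M: graded_left_module "weyl_algebra A m" "weyl_component A m" M Mg by fact
  let ?W = "weyl_algebra A m"
  let ?s = "\<Oplus>\<^bsub>?W\<^esub>i\<in>{1..m}. weyl_D A m i \<otimes>\<^bsub>?W\<^esub> weyl_X A m i"
  have "y = \<zero>\<^bsub>M\<^esub>" if y: "y \<in> Mg n" for y
  proof -
    have X: "weyl_X A m i \<odot>\<^bsub>M\<^esub> y = \<zero>\<^bsub>M\<^esub>" if "i \<in> {1..m}" for i
      using M.smult_degree[OF A.weyl_gen_component(1)[OF that] y] zero by (simp add: add.commute)
    have s: "?s \<in> carrier ?W"
      using A.weyl_gen_closed by (auto intro!: M.R.finsum_closed)
    have sy: "?s \<odot>\<^bsub>M\<^esub> y = \<zero>\<^bsub>M\<^esub>"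
      using X A.weyl_gen_closed M.component_closed[OF y] by (intro M.finsum_mult_smult_zero) auto
    obtain a :: nat where "(weyl_euler A m \<ominus>\<^bsub>?W\<^esub> [n] \<cdot>\<^bsub>?W\<^esub> \<one>\<^bsub>?W\<^esub>) [^]\<^bsub>?W\<^esub> a \<odot>\<^bsub>M\<^esub> y = \<zero>\<^bsub>M\<^esub>"
      using assms(5) y unfolding generalized_eulerian_def by blast
    moreover have "[(- int m - n)] \<cdot>\<^bsub>?W\<^esub> \<one>\<^bsub>?W\<^esub> \<in> Units ?W"
      using assms(6) by (intro A.weyl_int_unit[OF assms(2,3)]) simp
    ultimately show ?thesis
      using M.generalized_eigenvector_eq_zero[OF M.component_closed[OF y] s sy, of "- int m" n a]
      by (simp add: A.weyl_euler_eq)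
  qed
  with assms(7) M.component_zero[of n] show False by blast
qed

text \<open>If the component of degree \<open>n - 1\<close> vanishes, the Euler operator annihilates degree \<open>n\<close>.\<close>

lemma weyl_component_descend:
  assumes "cring A" "subfield K A" "characteristic_zero (A\<lparr>carrier := K\<rparr>)"
    and "graded_left_module (weyl_algebra A m) (weyl_component A m) M Mg"
    and "generalized_eulerian A m M Mg"
    and "n \<noteq> 0" "Mg n \<noteq> {\<zero>\<^bsub>M\<^esub>}"
  shows "Mg (n - 1) \<noteq> {\<zero>\<^bsub>M\<^esub>}"
proof
  assume zero: "Mg (n - 1) = {\<zero>\<^bsub>M\<^esub>}"
  interpret A: cring A by fact
  interpret M: graded_left_module "weyl_algebra A m" "weyl_component A m" M Mg by fact
  let ?W = "weyl_algebra A m"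
  have "y = \<zero>\<^bsub>M\<^esub>" if y: "y \<in> Mg n" for y
  proof -
    have D: "weyl_D A m i \<odot>\<^bsub>M\<^esub> y = \<zero>\<^bsub>M\<^esub>" if "i \<in> {1..m}" for i
      using M.smult_degree[OF A.weyl_gen_component(2)[OF that] y] zero by simp
    have s: "weyl_euler A m \<in> carrier ?W"
      unfolding weyl_euler_def using A.weyl_gen_closed by (auto intro!: M.R.finsum_closed)
    have sy: "weyl_euler A m \<odot>\<^bsub>M\<^esub> y = \<zero>\<^bsub>M\<^esub>"
      unfolding weyl_euler_def
      using D A.weyl_gen_closed M.component_closed[OF y] by (intro M.finsum_mult_smult_zero) auto
    obtain a :: nat where "(weyl_euler A m \<ominus>\<^bsub>?W\<^esub> [n] \<cdot>\<^bsub>?W\<^esub> \<one>\<^bsub>?W\<^esub>) [^]\<^bsub>?W\<^esub> a \<odot>\<^bsub>M\<^esub> y = \<zero>\<^bsub>M\<^esub>"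
      using assms(5) y unfolding generalized_eulerian_def by blast
    moreover have "[(0 - n)] \<cdot>\<^bsub>?W\<^esub> \<one>\<^bsub>?W\<^esub> \<in> Units ?W"
      using assms(6) by (intro A.weyl_int_unit[OF assms(2,3)]) simp
    moreover have "[(0::int)] \<cdot>\<^bsub>?W\<^esub> \<one>\<^bsub>?W\<^esub> = \<zero>\<^bsub>?W\<^esub>"
      by (simp add: M.R.int_mult_zero)
    ultimately show ?thesis
      using s M.generalized_eigenvector_eq_zero[OF M.component_closed[OF y] s sy, of 0 n a]
      by simp
  qed
  with assms(7) M.component_zero[of n] show False by blast
qed

section \<open>Tails of nonzero components\<close>

theorem corollary6p6:
  fixes A :: "('a, 'r) ring_scheme"
    and K :: "'a set"
    and m :: nat
    and M :: "((weyl_gen list \<Rightarrow> 'a) set, 'b, 'c) module_scheme"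
    and Mg :: "int \<Rightarrow> 'b set"
  assumes "cring A" and "noetherian_ring A"
    and "subfield K A" and "uncountable K" and "characteristic_zero (A\<lparr>carrier := K\<rparr>)"
    and "m \<ge> 1"
    and "graded_left_module (weyl_algebra A m) (weyl_component A m) M Mg"
    and "countably_generated (weyl_algebra A m) M"
    and "generalized_eulerian A m M Mg"
  shows "(\<forall>n\<^sub>0 \<ge> - int m + 1. Mg n\<^sub>0 \<noteq> {\<zero>\<^bsub>M\<^esub>} \<longrightarrow> (\<forall>n \<ge> n\<^sub>0. Mg n \<noteq> {\<zero>\<^bsub>M\<^esub>})) \<and>
         (\<forall>n\<^sub>0 \<le> - int m. Mg n\<^sub>0 \<noteq> {\<zero>\<^bsub>M\<^esub>} \<longrightarrow> (\<forall>n \<le> n\<^sub>0. Mg n \<noteq> {\<zero>\<^bsub>M\<^esub>}))"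
proof (intro conjI allI impI)
  fix n\<^sub>0 n :: int
  assume n0: "- int m + 1 \<le> n\<^sub>0" "Mg n\<^sub>0 \<noteq> {\<zero>\<^bsub>M\<^esub>}" and "n\<^sub>0 \<le> n"
  from \<open>n\<^sub>0 \<le> n\<close> show "Mg n \<noteq> {\<zero>\<^bsub>M\<^esub>}"
  proof (induction n rule: int_ge_induct)
    case base
    show ?case by (rule n0(2))
  next
    case (step i)
    then show ?case
      using n0(1) by (intro weyl_component_ascend[OF assms(1,3,5,7,9)]) auto
  qed
next
  fix n\<^sub>0 n :: int
  assume n0: "n\<^sub>0 \<le> - int m" "Mg n\<^sub>0 \<noteq> {\<zero>\<^bsub>M\<^esub>}" and "n \<le> n\<^sub>0"
  from \<open>n \<le> n\<^sub>0\<close> show "Mg n \<noteq> {\<zero>\<^bsub>M\<^esub>}"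
  proof (induction n rule: int_le_induct)
    case base
    show ?case by (rule n0(2))
  next
    case (step i)
    then show ?case
      using n0(1) assms(6) by (intro weyl_component_descend[OF assms(1,3,5,7,9)]) auto
  qed
qed

end
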